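(* Let $n\ge 2$ be an integer. Let $\mathcal{H}$ be a separable real Hilbert space with norm $\|\cdot\|_{\mathcal{H}}$, let $\mathcal{W}\subset\mathcal{H}$ be a nonempty convex, closed and bounded subset, and define its radius $$\mathsf{rad}_{\mathcal{H}}(\mathcal{W})=\inf_{w\in\mathcal{W}}\sup_{w'\in\mathcal{W}}\|w-w'\|_{\mathcal{H}}.$$ Let $\mathcal{A}$ be a randomized algorithm with data space $\mathcal{Z}$ taking values in $\mathcal{W}$, and let $\mathcal{Q}_n$ be a resampling distribution on $\mathrm{seq}_{[n]}$ that satisfies the symmetry, nontrivial subsampling, nonpositive covariance and leave-one-out compatibility conditions (with associated distribution $\mathcal{Q}_{n-1}$). Then derandomized bagging, run with base algorithm $\mathcal{A}$ and resampling distribution $\mathcal{Q}_n$, has mean-square stability $\beta^2$ with respect to $\|\cdot\|_{\mathcal{H}}$ (at sample size $n$), with $$\beta^2:=\frac{\mathsf{rad}_{\mathcal{H}}^2(\mathcal{W})}{n-1}\cdot\frac{p_{\mathcal{Q}_n}}{1-p_{\mathcal{Q}_n}}.$$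
   Context: Randomized algorithm: let $\mathcal{Z}$ be a set (the data space). A randomized algorithm is a map $\mathcal{A}:\bigcup_{n\ge0}\mathcal{Z}^n\times[0,1]\to\mathcal{W}$, $(\mathcal{D},\xi)\mapsto\mathcal{A}(\mathcal{D};\xi)$, such that for each fixed data set $\mathcal{D}$ the map $t\mapsto\mathcal{A}(\mathcal{D};t)$ is measurable (Borel $\sigma$-algebra on $\mathcal{W}$). The seed $\xi$ is drawn from $\mathrm{Uniform}[0,1]$. The algorithm is deterministic if it does not depend on $\xi$. Bags: $\mathrm{seq}_{[n]}=\{(i_1,\dots,i_k):k\ge0,\ i_1,\dots,i_k\in[n]\}$ is the set of finite sequences in $[n]=\{1,\dots,n\}$. For $r=(i_1,\dots,i_k)\in\mathrm{seq}_{[n]}$ and $\mathcal{D}=(Z_1,\dots,Z_n)$, write $\mathcal{D}^r=(Z_{i_1},\dots,Z_{i_k})$; write $i\in r$ if $i$ occurs among the entries of $r$. Conditions on a probability distribution $\mathcal{Q}_n$ on $\mathrm{seq}_{[n]}$: - Symmetry: $\mathcal{Q}_n\{(i_1,\dots,i_m)\}=\mathcal{Q}_n\{(\sigma(i_1),\dots,\sigma(i_m))\}$ for all $m\ge1$, $i_1,\dots,i_m\in[n]$ and permutations $\sigma$ of $[n]$. - Nontrivial subsampling: $p_{\mathcal{Q}_n}<1$, where $p_{\mathcal{Q}_n}=\mathbb{E}_{r\sim\mathcal{Q}_n}\big[\frac1n\sum_{i=1}^n\mathbf{1}\{i\in r\}\big]$. - Nonpositive covariance: $\mathrm{Cov}_{r\sim\mathcal{Q}_n}(\mathbf{1}_{i\in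 r},\mathbf{1}_{j\in r})\le0$ for all $i\ne j\in[n]$. - Leave-one-out compatibility: the corresponding distribution $\mathcal{Q}_{n-1}$ on $\mathrm{seq}_{[n-1]}$ (used for data sets of size $n-1$) equals the distribution of $r\sim\mathcal{Q}_n$ conditional on the event $n\notin r$. Derandomized bagging with base algorithm $\mathcal{A}$ and resampling distribution $\mathcal{Q}_n$: the deterministic algorithm that on $\mathcal{D}\in\mathcal{Z}^n$ returns $\hat w=\mathbb{E}_{r,\xi}[\mathcal{A}(\mathcal{D}^r;\xi)]$, with $(r,\xi)\sim\mathcal{Q}_n\times\mathrm{Uniform}[0,1]$ (vector-valued expectation), and on a data set of size $n-1$ does the same with $\mathcal{Q}_{n-1}$ in place of $\mathcal{Q}_n$. Mean-square stability: an algorithm (at sample size $n$) has mean-square stability $\beta^2$ with respect to a norm $\|\cdot\|$ if for all $\mathcal{D}=(Z_1,\dots,Z_n)\in\mathcal{Z}^n$, $\frac1n\sum_{i=1}^n\mathbb{E}_\xi[\|\hat w-\hat w^{\setminus i}\|^2]\le\beta^2$, where $\hat w$ is its output on $\mathcal{D}$ and $\hat w^{\setminus i}$ its output, with the same seed $\xi$, on $\mathcal{D}^{\setminus i}=(Z_j)_{j\ne i}\in\mathcal{Z}^{n-1}$ (the expectation is vacuous for deterministic algorithms). *)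

theory Defs
  imports "HOL-Probability.Probability" "HOL-Combinatorics.Permutations"
begin

(* Uniform[0,1], with underlying space exactly the unit interval;
   no normalisation is needed because the interval has Lebesgue measure 1. *)
definition unif01 :: "real measure" where
  "unif01 = restrict_space lborel {0..1}"

(* Data sets are lists over the data space 'z. Membership in this function space includes
   A D t \<in> W for all t in [0,1]; values of A D outside the unit interval are irrelevant. *)
definition randomized_algorithm ::
  "'h::topological_space set \<Rightarrow> ('z list \<Rightarrow> real \<Rightarrow> 'h) \<Rightarrow> bool" where
  "randomized_algorithm W A \<longleftrightarrow> (\<forall>D. A D \<in> unif01 \<rightarrow>\<^sub>M restrict_space borel W)"

definition seqs :: "nat \<Rightarrow> nat list set" where
  "seqs n = lists {1..n}"

(* The indices in a bag are 1-based, whereas list positions are 0-based.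
   For r in seqs (length D) no position is out of range. *)
definition resample :: "'z list \<Rightarrow> nat list \<Rightarrow> 'z list" where
  "resample D r = map (\<lambda>i. D ! (i - 1)) r"

definition remove_point :: "nat \<Rightarrow> 'z list \<Rightarrow> 'z list" where
  "remove_point i D = take (i - 1) D @ drop i D"

definition covariance :: "'a measure \<Rightarrow> ('a \<Rightarrow> real) \<Rightarrow> ('a \<Rightarrow> real) \<Rightarrow> real" where
  "covariance M X Y =
     (\<integral>x. (X x - (\<integral>y. X y \<partial>M)) * (Y x - (\<integral>y. Y y \<partial>M)) \<partial>M)"

definition in_bag :: "nat \<Rightarrow> nat list \<Rightarrow> real" where
  "in_bag i r = of_bool (i \<in> set r)"

definition symmetric_resampling :: "nat \<Rightarrow> nat list pmf \<Rightarrow> bool" where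
  "symmetric_resampling n Q \<longleftrightarrow>
     (\<forall>r \<in> seqs n. r \<noteq> [] \<longrightarrow> (\<forall>\<sigma>. \<sigma> permutes {1..n} \<longrightarrow> pmf Q r = pmf Q (map \<sigma> r)))"

definition subsampling_rate :: "nat \<Rightarrow> nat list pmf \<Rightarrow> real" where
  "subsampling_rate n Q = measure_pmf.expectation Q (\<lambda>r. 1 / real n * (\<Sum>i = 1..n. in_bag i r))"

definition nontrivial_subsampling :: "nat \<Rightarrow> nat list pmf \<Rightarrow> bool" where
  "nontrivial_subsampling n Q \<longleftrightarrow> subsampling_rate n Q < 1"

definition nonpositive_covariance :: "nat \<Rightarrow> nat list pmf \<Rightarrow> bool" where
  "nonpositive_covariance n Q \<longleftrightarrow>
     (\<forall>i \<in> {1..n}. \<forall>j \<in> {1..n}. i \<noteq> j \<longrightarrow> covariance (measure_pmf Q) (in_bag i) (in_bag j) \<le> 0)"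

(* cond_pmf is meaningful only if the conditioning event has positive probability;
   for n \<ge> 1 symmetry and nontrivial subsampling guarantee this. *)
definition leave_one_out_compatible :: "nat \<Rightarrow> nat list pmf \<Rightarrow> nat list pmf \<Rightarrow> bool" where
  "leave_one_out_compatible n Q Q' \<longleftrightarrow> Q' = cond_pmf Q {r. n \<notin> set r}"

(* Q m is the resampling distribution used for data sets of size m. *)
definition derandomized_bagging ::
  "('z list \<Rightarrow> real \<Rightarrow> 'h::{banach, second_countable_topology}) \<Rightarrow> (nat \<Rightarrow> nat list pmf) \<Rightarrow> 'z list \<Rightarrow> 'h" where
  "derandomized_bagging A Q D =
     (\<integral>(r, \<xi>). A (resample D r) \<xi> \<partial>(measure_pmf (Q (length D)) \<Otimes>\<^sub>M unif01))"

(* Integrability is required explicitly because the Bochner integral of a non-integrable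
   function is 0, which would make the bound hold spuriously. *)
definition mean_square_stable ::
  "nat \<Rightarrow> real \<Rightarrow> ('z list \<Rightarrow> real \<Rightarrow> 'h::real_normed_vector) \<Rightarrow> bool" where
  "mean_square_stable n \<beta>2 B \<longleftrightarrow>
     (\<forall>D. length D = n \<longrightarrow>
        (\<forall>i \<in> {1..n}. integrable unif01 (\<lambda>\<xi>. (norm (B D \<xi> - B (remove_point i D) \<xi>))\<^sup>2)) \<and>
        1 / real n * (\<Sum>i = 1..n. \<integral>\<xi>. (norm (B D \<xi> - B (remove_point i D) \<xi>))\<^sup>2 \<partial>unif01) \<le> \<beta>2)"

definition rad :: "'h::real_normed_vector set \<Rightarrow> real" where
  "rad W = (INF w\<in>W. SUP w'\<in>W. norm (w - w'))"

end

theory Submission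
  imports Defs
begin

text \<open>
  Let \<open>f r\<close> be the expected output on the bag \<open>r\<close>, \<open>p\<close> the subsampling rate, \<open>c \<in> W\<close> and
  \<open>X\<^sub>i = in_bag i - p\<close>. By symmetry and leave-one-out compatibility the leave-one-out output is
  the conditional expectation of \<open>f\<close> given \<open>i \<notin> r\<close>, so that it differs from the full output by
  \<open>v\<^sub>i / (1 - p)\<close> with \<open>v\<^sub>i = E[X\<^sub>i (f - c)]\<close>. The covariance matrix of the \<open>X\<^sub>i\<close> has
  constant diagonal \<open>s = p (1 - p)\<close> and constant off-diagonal entries \<open>\<rho> \<le> 0\<close>; its largest
  eigenvalue \<open>s - \<rho>\<close> is at most \<open>s n / (n - 1)\<close> since the variance of \<open>\<Sum>\<^sub>i X\<^sub>i\<close> is nonnegative.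
  A Bessel-type inequality then bounds \<open>\<Sum>\<^sub>i |v\<^sub>i|\<^sup>2\<close> by \<open>s - \<rho>\<close> times the squared supremum of
  \<open>|f - c|\<close>, and \<open>c\<close> is chosen as an approximate centre of \<open>W\<close>.
\<close>

section \<open>A Bessel-type inequality for variables with an exchangeable covariance matrix\<close>

lemma integrable_pmf_bounded:
  fixes f :: "'a \<Rightarrow> 'b::{banach, second_countable_topology}"
  assumes "\<And>x. x \<in> set_pmf M \<Longrightarrow> norm (f x) \<le> B"
  shows "integrable (measure_pmf M) f"
  by (rule measure_pmf.integrable_const_bound[where B = B]) (use assms in \<open>auto simp: AE_measure_pmf_iff\<close>)

lemma power2_norm_sum_scaleR:
  fixes v :: "'a \<Rightarrow> 'h::real_inner"
  shows "(norm (\<Sum>i\<in>I. a i *\<^sub>R v i))\<^sup>2 = (\<Sum>i\<in>I. \<Sum>j\<in>I. a i * a j * inner (v i) (v j))"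
  unfolding power2_norm_eq_inner
  by (subst inner_sum_left) (simp add: inner_sum_right sum_distrib_left mult_ac)

text \<open>The matrix with \<open>s\<close> on the diagonal and \<rho> elsewhere is (s - \<rho>)
  times the identity plus \<rho> times the all-ones matrix; the two summands are the contributions
  of these two parts.\<close>

lemma sum_sum_exchangeable:
  fixes u :: "'a \<Rightarrow> 'a \<Rightarrow> real"
  assumes "finite I"
  shows "(\<Sum>i\<in>I. \<Sum>j\<in>I. (if i = j then s else \<rho>) * u i j)
     = (s - \<rho>) * (\<Sum>i\<in>I. u i i) + \<rho> * (\<Sum>i\<in>I. \<Sum>j\<in>I. u i j)"
proof -
  have "(\<Sum>j\<in>I. (if i = j then s else \<rho>) * u i j) = (s - \<rho>) * u i i + \<rho> * (\<Sum>j\<in>I. u i j)"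
    if "i \<in> I" for i
  proof -
    have "(\<Sum>j\<in>I. (if i = j then s else \<rho>) * u i j)
        = (\<Sum>j\<in>I. (if i = j then (s - \<rho>) * u i j else 0) + \<rho> * u i j)"
      by (intro sum.cong) (auto simp: algebra_simps)
    also have "\<dots> = (s - \<rho>) * u i i + \<rho> * (\<Sum>j\<in>I. u i j)"
      using assms that by (simp add: sum.distrib sum_distrib_left)
    finally show ?thesis .
  qed
  then show ?thesis
    by (simp add: sum.distrib sum_distrib_left)
qed

text \<open>Expanding the square leaves only the second moments of the \<open>X i\<close>. The
  identity serves twice: with all \<open>v i = 1\<close> it yields the lower bound on \<rho>, with
  general vectors the second moment of the dual sum in the Bessel inequality.\<close>

lemma exchangeable_norm_sum:
  fixes X :: "'i \<Rightarrow> 'a \<Rightarrow> real" and v :: "'i \<Rightarrow> 'h::real_inner"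
  assumes "finite I"
    and X: "\<And>i x. i \<in> I \<Longrightarrow> x \<in> set_pmf M \<Longrightarrow> \<bar>X i x\<bar> \<le> 1"
    and cov: "\<And>i j. i \<in> I \<Longrightarrow> j \<in> I \<Longrightarrow>
      measure_pmf.expectation M (\<lambda>x. X i x * X j x) = (if i = j then s else \<rho>)"
  shows "measure_pmf.expectation M (\<lambda>x. (norm (\<Sum>i\<in>I. X i x *\<^sub>R v i))\<^sup>2)
     = (s - \<rho>) * (\<Sum>i\<in>I. (norm (v i))\<^sup>2) + \<rho> * (norm (\<Sum>i\<in>I. v i))\<^sup>2"
proof -
  have int: "integrable M (\<lambda>x. X i x * X j x * inner (v i) (v j))" if "i \<in> I" "j \<in> I" for i j
  proof (rule integrable_mult_left, rule integrable_pmf_bounded)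
    fix x assume "x \<in> set_pmf M"
    then show "norm (X i x * X j x) \<le> 1 * 1"
      unfolding real_norm_def abs_mult using X that by (intro mult_mono) auto
  qed
  have "measure_pmf.expectation M (\<lambda>x. (norm (\<Sum>i\<in>I. X i x *\<^sub>R v i))\<^sup>2)
      = (\<Sum>i\<in>I. \<Sum>j\<in>I. measure_pmf.expectation M (\<lambda>x. X i x * X j x * inner (v i) (v j)))"
    unfolding power2_norm_sum_scaleR
    by (subst Bochner_Integration.integral_sum, intro Bochner_Integration.integrable_sum int; assumption?)
       (intro sum.cong refl Bochner_Integration.integral_sum int)
  also have "\<dots> = (\<Sum>i\<in>I. \<Sum>j\<in>I. (if i = j then s else \<rho>) * inner (v i) (v j))"
    using cov by (intro sum.cong refl) simp
  also have "\<dots> = (s - \<rho>) * (\<Sum>i\<in>I. (norm (v i))\<^sup>2) + \<rho> * (norm (\<Sum>i\<in>I. v i))\<^sup>2"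
    unfolding sum_sum_exchangeable[OF \<open>finite I\<close>]
    using power2_norm_sum_scaleR[of "\<lambda>_. 1" v I] by (simp add: power2_norm_eq_inner)
  finally show ?thesis .
qed

text \<open>A duality argument: for \<open>Y = \<Sum>i\<in>I. X i *\<^sub>R v i\<close> the expected
  inner product of \<open>g\<close> and \<open>Y\<close> gives back \<open>S\<close>, while the
  second moment of \<open>Y\<close> is at most (s - \<rho>) times \<open>S\<close>. Expanding the
  expected squared norm of \<open>\<kappa> *\<^sub>R g - Y\<close> turns this into a bound on
  \<open>S\<close> for each \<kappa> above s - \<rho>.\<close>

lemma exchangeable_bessel:
  fixes X :: "'i \<Rightarrow> 'a \<Rightarrow> real" and g :: "'a \<Rightarrow> 'h::{real_inner, banach, second_countable_topology}"
  assumes I: "finite I" "card I \<ge> 2"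
    and X: "\<And>i x. i \<in> I \<Longrightarrow> x \<in> set_pmf M \<Longrightarrow> \<bar>X i x\<bar> \<le> 1"
    and cov: "\<And>i j. i \<in> I \<Longrightarrow> j \<in> I \<Longrightarrow>
      measure_pmf.expectation M (\<lambda>x. X i x * X j x) = (if i = j then s else \<rho>)"
    and \<rho>: "\<rho> \<le> 0"
    and g: "\<And>x. x \<in> set_pmf M \<Longrightarrow> norm (g x) \<le> R"
  shows "(\<Sum>i\<in>I. (norm (measure_pmf.expectation M (\<lambda>x. X i x *\<^sub>R g x)))\<^sup>2)
     \<le> R\<^sup>2 * (s * card I / (card I - 1))"
proof -
  define v where "v i = measure_pmf.expectation M (\<lambda>x. X i x *\<^sub>R g x)" for i
  define S where "S = (\<Sum>i\<in>I. (norm (v i))\<^sup>2)"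
  define Y where "Y x = (\<Sum>i\<in>I. X i x *\<^sub>R v i)" for x
  define B where "B = (\<Sum>i\<in>I. norm (v i))"
  have S0: "S \<ge> 0" unfolding S_def by (simp add: sum_nonneg)
  obtain x0 where "x0 \<in> set_pmf M" using set_pmf_not_empty[of M] by blast
  then have R: "R \<ge> 0" using g[of x0] norm_ge_zero[of "g x0"] by linarith
  obtain i0 where "i0 \<in> I" using I by fastforce
  have "s = measure_pmf.expectation M (\<lambda>x. X i0 x * X i0 x)"
    using cov \<open>i0 \<in> I\<close> by simp
  then have s: "s \<ge> 0" by simp
  \<comment> \<open>The second moment of the plain sum of the \<open>X i\<close> keeps \<rho> from
    being too negative: -\<rho> is at most s / (card I - 1), which is the source of the factor card
    I / (card I - 1).\<close>
  have "0 \<le> measure_pmf.expectation M (\<lambda>x. (norm (\<Sum>i\<in>I. X i x *\<^sub>R (1::real)))\<^sup>2)"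
    by (rule integral_nonneg_AE) simp
  also have "\<dots> = (s - \<rho>) * card I + \<rho> * (card I)\<^sup>2"
    using exchangeable_norm_sum[OF I(1) X cov, where v = "\<lambda>_. 1::real"] by simp
  also have "\<dots> = card I * (s + \<rho> * (real (card I) - 1))"
    by (simp add: algebra_simps power2_eq_square)
  finally have "0 \<le> s + \<rho> * (real (card I) - 1)"
    using I by (auto simp: zero_le_mult_iff)
  then have \<kappa>: "s - \<rho> \<le> s * card I / (card I - 1)"
    using I by (simp add: field_simps of_nat_diff)
  have Yb: "norm (Y x) \<le> B" if "x \<in> set_pmf M" for x
    unfolding Y_def B_def using X that by (intro sum_norm_le) (simp add: mult_left_le_one_le)
  have "measure_pmf.expectation M (\<lambda>x. (norm (Y x))\<^sup>2) = (s - \<rho>) * S + \<rho> * (norm (\<Sum>i\<in>I. v i))\<^sup>2"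
    unfolding Y_def S_def by (rule exchangeable_norm_sum[OF I(1) X cov])
  \<comment> \<open>The sign of \<rho> enters here: the all-ones part of the covariance contributes
    a nonpositive term.\<close>
  also have "\<dots> \<le> (s - \<rho>) * S" using \<rho> by (simp add: mult_nonpos_nonneg)
  finally have EY: "measure_pmf.expectation M (\<lambda>x. (norm (Y x))\<^sup>2) \<le> (s - \<rho>) * S" .
  have int: "integrable M (\<lambda>x. X i x *\<^sub>R g x)" if "i \<in> I" for i
  proof (rule integrable_pmf_bounded)
    fix x assume "x \<in> set_pmf M"
    then show "norm (X i x *\<^sub>R g x) \<le> 1 * R"
      unfolding norm_scaleR using X that g by (intro mult_mono) auto
  qed
  have "measure_pmf.expectation M (\<lambda>x. inner (g x) (Y x))
      = measure_pmf.expectation M (\<lambda>x. \<Sum>i\<in>I. inner (X i x *\<^sub>R g x) (v i))"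
    unfolding Y_def by (simp add: inner_sum_right)
  also have "\<dots> = (\<Sum>i\<in>I. measure_pmf.expectation M (\<lambda>x. inner (X i x *\<^sub>R g x) (v i)))"
    using int by (intro Bochner_Integration.integral_sum integrable_inner_left) auto
  also have "\<dots> = (\<Sum>i\<in>I. inner (v i) (v i))"
    unfolding v_def using int by (intro sum.cong refl integral_inner_left) auto
  also have "\<dots> = S" by (simp add: S_def power2_norm_eq_inner)
  finally have EgY: "measure_pmf.expectation M (\<lambda>x. inner (g x) (Y x)) = S" .
  have intg: "integrable M (\<lambda>x. (norm (g x))\<^sup>2)"
    by (rule integrable_pmf_bounded[where B = "R\<^sup>2"]) (use g in \<open>auto intro: power_mono\<close>)
  have intY: "integrable M (\<lambda>x. (norm (Y x))\<^sup>2)"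
    by (rule integrable_pmf_bounded[where B = "B\<^sup>2"]) (use Yb in \<open>auto intro: power_mono\<close>)
  have intgY: "integrable M (\<lambda>x. inner (g x) (Y x))"
    by (rule integrable_pmf_bounded[where B = "R * B"])
       (use g Yb R in \<open>auto intro!: order_trans[OF Cauchy_Schwarz_ineq2] mult_mono\<close>)
  have "measure_pmf.expectation M (\<lambda>x. (norm (g x))\<^sup>2) \<le> measure_pmf.expectation M (\<lambda>x. R\<^sup>2)"
    using g by (intro integral_mono_AE intg) (auto simp: AE_measure_pmf_iff intro: power_mono)
  then have Eg: "measure_pmf.expectation M (\<lambda>x. (norm (g x))\<^sup>2) \<le> R\<^sup>2" by simp
  \<comment> \<open>Strict inequality, because \<open>s - \<rho>\<close> may vanish and \<open>\<kappa>\<close> is cancelled below.\<close>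
  have bound: "S \<le> R\<^sup>2 * \<kappa>" if \<kappa>': "s - \<rho> < \<kappa>" for \<kappa>
  proof -
    have pos: "\<kappa> > 0" using \<kappa>' s \<rho> by linarith
    have "0 \<le> measure_pmf.expectation M (\<lambda>x. (norm (\<kappa> *\<^sub>R g x - Y x))\<^sup>2)"
      by (rule integral_nonneg_AE) simp
    also have "\<dots> = measure_pmf.expectation M
        (\<lambda>x. \<kappa>\<^sup>2 * (norm (g x))\<^sup>2 - 2 * \<kappa> * inner (g x) (Y x) + (norm (Y x))\<^sup>2)"
      by (intro Bochner_Integration.integral_cong refl)
         (simp add: power2_norm_eq_inner inner_diff_left inner_diff_right inner_commute
          right_diff_distrib power2_eq_square[of \<kappa>])
    also have "\<dots> = \<kappa>\<^sup>2 * measure_pmf.expectation M (\<lambda>x. (norm (g x))\<^sup>2) - 2 * \<kappa> * S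
        + measure_pmf.expectation M (\<lambda>x. (norm (Y x))\<^sup>2)"
      using intg intY intgY EgY by simp
    also have "\<dots> \<le> \<kappa>\<^sup>2 * R\<^sup>2 - 2 * \<kappa> * S + \<kappa> * S"
      using mult_left_mono[OF Eg zero_le_power2[of \<kappa>]] EY mult_right_mono[OF less_imp_le[OF \<kappa>'] S0]
      by linarith
    finally have "\<kappa> * S \<le> \<kappa> * (R\<^sup>2 * \<kappa>)"
      by (simp add: power2_eq_square algebra_simps)
    then show ?thesis using pos by simp
  qed
  \<comment> \<open>Let \<kappa> decrease to s - \<rho>, which also covers the degenerate case s =
    \<rho>.\<close>
  have "S \<le> R\<^sup>2 * (s - \<rho>)"
  proof (rule tendsto_lowerbound)
    show "((\<lambda>\<kappa>. R\<^sup>2 * \<kappa>) \<longlongrightarrow> R\<^sup>2 * (s - \<rho>)) (at_right (s - \<rho>))"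
      by (intro tendsto_intros)
    show "\<forall>\<^sub>F \<kappa> in at_right (s - \<rho>). S \<le> R\<^sup>2 * \<kappa>"
      using bound by (auto simp: eventually_at_right_less intro: eventually_mono[OF eventually_at_right_less])
  qed simp
  also have "\<dots> \<le> R\<^sup>2 * (s * card I / (card I - 1))"
    using \<kappa> by (intro mult_left_mono) auto
  finally show ?thesis unfolding S_def v_def .
qed

section \<open>Conditioning, and invariance under relabelling of indices\<close>

text \<open>Written against counting measure, the two integrands differ only by the constant 1 /
  \<open>measure_pmf.prob Q S\<close>, so a nonintegrable \<open>h\<close> gives 0 on both
  sides.\<close>

lemma expectation_cond_pmf:
  fixes h :: "'a \<Rightarrow> 'h::{banach, second_countable_topology}"
  assumes "set_pmf Q \<inter> S \<noteq> {}"
  shows "measure_pmf.expectation (cond_pmf Q S) h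
    = (1 / measure_pmf.prob Q S) *\<^sub>R measure_pmf.expectation Q (\<lambda>r. indicator S r *\<^sub>R h r)"
proof -
  have 1: "measure_pmf.expectation P k = (\<integral>x. pmf P x *\<^sub>R k x \<partial>count_space UNIV)"
    for P :: "'a pmf" and k :: "'a \<Rightarrow> 'h"
    unfolding measure_pmf_eq_density by (subst integral_density) auto
  have "(\<integral>x. pmf (cond_pmf Q S) x *\<^sub>R h x \<partial>count_space UNIV)
     = (\<integral>x. (1 / measure_pmf.prob Q S) *\<^sub>R (pmf Q x *\<^sub>R (indicator S x *\<^sub>R h x)) \<partial>count_space UNIV)"
    by (intro Bochner_Integration.integral_cong refl) (simp add: pmf_cond[OF assms] indicator_def)
  also have "\<dots> = (1 / measure_pmf.prob Q S) *\<^sub>R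
      (\<integral>x. pmf Q x *\<^sub>R (indicator S x *\<^sub>R h x) \<partial>count_space UNIV)"
    by (rule integral_scaleR_right)
  finally show ?thesis unfolding 1 .
qed

lemma map_permutes_mem_seqs_iff:
  assumes "\<sigma> permutes {1..n}"
  shows "map \<sigma> r \<in> seqs n \<longleftrightarrow> r \<in> seqs n"
  using permutes_in_image[OF assms] by (auto simp: seqs_def in_lists_conv_set)

text \<open>Symmetry is stated for nonempty bags in \<open>seqs n\<close> only. The empty bag is
  fixed by \<open>map \<sigma>\<close>, and lists outside \<open>seqs n\<close> have mass 0 before
  and after relabelling, so the whole distribution is invariant.\<close>

lemma symmetric_resampling_map_pmf:
  assumes "symmetric_resampling n Q" "set_pmf Q \<subseteq> seqs n" "\<sigma> permutes {1..n}"
  shows "map_pmf (map \<sigma>) Q = Q"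
proof (rule pmf_eqI)
  fix r
  define r' where "r' = map (inv \<sigma>) r"
  have r: "r = map \<sigma> r'"
    using assms(3) by (simp add: r'_def permutes_inverses(1) map_idI comp_def)
  have "inj \<sigma>" using assms(3) by (rule permutes_inj)
  then have "pmf (map_pmf (map \<sigma>) Q) r = pmf Q r'"
    unfolding r by (intro pmf_map_inj') simp
  also have "\<dots> = pmf Q r"
  proof (cases "r' \<in> seqs n")
    case True
    show ?thesis
    proof (cases "r' = []")
      case False
      with True assms(1,3) show ?thesis
        unfolding r symmetric_resampling_def by metis
    qed (simp add: r)
  next
    case False
    then have "r \<notin> seqs n" unfolding r using map_permutes_mem_seqs_iff[OF assms(3)] by simp
    then show ?thesis using False assms(2) by (metis pmf_eq_0_set_pmf subsetD)
  qed
  finally show "pmf (map_pmf (map \<sigma>) Q) r = pmf Q r" .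
qed

lemma symmetric_resampling_expectation:
  fixes h :: "nat list \<Rightarrow> 'h::{banach, second_countable_topology}"
  assumes "symmetric_resampling n Q" "set_pmf Q \<subseteq> seqs n" "\<sigma> permutes {1..n}"
  shows "measure_pmf.expectation Q (\<lambda>r. h (map \<sigma> r)) = measure_pmf.expectation Q h"
  using integral_map_pmf[of "map \<sigma>" Q h] symmetric_resampling_map_pmf[OF assms] by simp

lemma in_bag_map:
  assumes "\<sigma> permutes A"
  shows "in_bag (\<sigma> i) (map \<sigma> r) = in_bag i r"
  using permutes_inj[OF assms] by (auto simp: in_bag_def inj_def)

text \<open>Double transitivity, which makes all off-diagonal covariances equal. The first
  transposition takes \<open>i\<close> to \<open>k\<close>; the second takes the image
  \<open>j'\<close> of \<open>j\<close> to \<open>l\<close> and leaves \<open>k\<close> fixed, since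
  \<open>k\<close> differs from both \<open>j'\<close> and \<open>l\<close>.\<close>

lemma exists_permutes_pair:
  assumes "i \<in> A" "j \<in> A" "k \<in> A" "l \<in> A" "i \<noteq> j" "k \<noteq> l"
  shows "\<exists>\<sigma>. \<sigma> permutes A \<and> \<sigma> i = k \<and> \<sigma> j = l"
proof -
  define j' where "j' = Transposition.transpose i k j"
  have j': "j' \<in> A" "j' \<noteq> k"
    using assms by (auto simp: j'_def Transposition.transpose_def)
  have "Transposition.transpose j' l \<circ> Transposition.transpose i k permutes A"
    using assms j' by (intro permutes_compose permutes_swap_id) auto
  moreover have "(Transposition.transpose j' l \<circ> Transposition.transpose i k) i = k"
    using assms j' by (simp add: Transposition.transpose_def)
  moreover have "(Transposition.transpose j' l \<circ> Transposition.transpose i k) j = l"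
    by (simp add: j'_def[symmetric])
  ultimately show ?thesis by blast
qed

section \<open>Moments of bag membership, and deletion of a data point\<close>

text \<open>Transpositions show that all indices have the same inclusion probability, which is
  therefore their average.\<close>

lemma expectation_in_bag:
  assumes "symmetric_resampling n Q" "set_pmf Q \<subseteq> seqs n" "i \<in> {1..n}"
  shows "measure_pmf.expectation Q (in_bag i) = subsampling_rate n Q"
proof -
  have *: "measure_pmf.expectation Q (in_bag j) = measure_pmf.expectation Q (in_bag i)"
    if "j \<in> {1..n}" for j
  proof -
    have \<sigma>: "Transposition.transpose i j permutes {1..n}"
      using assms(3) that by (rule permutes_swap_id)
    show ?thesis
      using symmetric_resampling_expectation[OF assms(1,2) \<sigma>, of "in_bag j"] in_bag_map[OF \<sigma>, of i]
      by simp
  qed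
  have "subsampling_rate n Q = 1 / real n * (\<Sum>j = 1..n. measure_pmf.expectation Q (in_bag j))"
    unfolding subsampling_rate_def
    by (simp, subst Bochner_Integration.integral_sum)
       (auto intro!: integrable_pmf_bounded[where B = 1] simp: in_bag_def)
  also have "(\<Sum>j = 1..n. measure_pmf.expectation Q (in_bag j))
      = (\<Sum>j = 1..n. measure_pmf.expectation Q (in_bag i))"
    by (intro sum.cong refl *)
  also have "1 / real n * \<dots> = measure_pmf.expectation Q (in_bag i)"
    using assms(3) by simp
  finally show ?thesis by simp
qed

lemma prob_notin_bag:
  "measure_pmf.prob Q {r. i \<notin> set r} = 1 - measure_pmf.expectation Q (in_bag i)"
proof -
  have "in_bag i = indicator {r. i \<in> set r}" by (auto simp: in_bag_def indicator_def)
  then have "measure_pmf.expectation Q (in_bag i) = measure_pmf.prob Q {r. i \<in> set r}" by simp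
  then show ?thesis
    using measure_pmf.prob_compl[of "{r. i \<in> set r}" Q] by (simp add: set_diff_eq)
qed

text \<open>The reference pair \<open>k\<close>, \<open>l\<close> provides one common off-diagonal
  value: a permutation carries any pair of distinct indices to it. On the diagonal an indicator
  equals its own square.\<close>

lemma expectation_centered_in_bag:
  assumes sym: "symmetric_resampling n Q" "set_pmf Q \<subseteq> seqs n" and ij: "i \<in> {1..n}" "j \<in> {1..n}"
    and kl: "k \<in> {1..n}" "l \<in> {1..n}" "k \<noteq> l"
  defines "p \<equiv> subsampling_rate n Q"
  shows "measure_pmf.expectation Q (\<lambda>r. (in_bag i r - p) * (in_bag j r - p))
    = (if i = j then p * (1 - p) else covariance (measure_pmf Q) (in_bag k) (in_bag l))"
proof (cases "i = j")
  case True
  have "(in_bag i r - p) * (in_bag i r - p) = (1 - 2 * p) * in_bag i r + p\<^sup>2" for r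
    by (simp add: in_bag_def power2_eq_square algebra_simps)
  moreover have "integrable Q (in_bag i)"
    by (rule integrable_pmf_bounded[where B = 1]) (simp add: in_bag_def)
  ultimately have "measure_pmf.expectation Q (\<lambda>r. (in_bag i r - p) * (in_bag i r - p))
      = (1 - 2 * p) * p + p\<^sup>2"
    using expectation_in_bag[OF sym ij(1)] by (simp add: p_def[symmetric])
  then show ?thesis
    using True by (simp add: algebra_simps power2_eq_square)
next
  case False
  obtain \<sigma> where \<sigma>: "\<sigma> permutes {1..n}" "\<sigma> i = k" "\<sigma> j = l"
    using exists_permutes_pair[OF ij kl(1,2) False kl(3)] by blast
  show ?thesis
    using symmetric_resampling_expectation[OF sym \<sigma>(1),
        of "\<lambda>r. (in_bag k r - p) * (in_bag l r - p)"]
      in_bag_map[OF \<sigma>(1), of i] in_bag_map[OF \<sigma>(1), of j] False \<sigma>(2,3)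
      expectation_in_bag[OF sym kl(1)] expectation_in_bag[OF sym kl(2)]
    by (simp add: covariance_def p_def)
qed

text \<open>The cyclic permutation \<open>\<sigma>\<close> sends positions of the shortened data set to positions of the
  full one and \<open>n\<close> to the removed index, so it carries the event \<open>n \<notin> r\<close> to \<open>i \<notin> r\<close>.\<close>
lemma remove_point_permutation:
  assumes i: "i \<in> {1..n}" and D: "length D = n"
  obtains \<sigma> where "\<sigma> permutes {1..n}" "\<sigma> n = i"
    "\<And>r. r \<in> seqs (n - 1) \<Longrightarrow> resample (remove_point i D) r = resample D (map \<sigma> r)"
proof -
  define \<sigma> where "\<sigma> j = (if j = n then i else if i \<le> j \<and> j < n then j + 1 else j)" for j
  have "bij_betw \<sigma> {1..n} {1..n}"
  proof -
    have "inj_on \<sigma> {1..n}" using i by (auto simp: \<sigma>_def inj_on_def split: if_splits)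
    moreover have "\<sigma> ` {1..n} \<subseteq> {1..n}" using i by (auto simp: \<sigma>_def)
    ultimately show ?thesis using endo_inj_surj[of "{1..n}" \<sigma>] by (simp add: bij_betw_def)
  qed
  then have "\<sigma> permutes {1..n}"
    using i by (intro bij_imp_permutes) (auto simp: \<sigma>_def)
  moreover have "\<sigma> n = i" by (simp add: \<sigma>_def)
  moreover have "resample (remove_point i D) r = resample D (map \<sigma> r)" if "r \<in> seqs (n - 1)" for r
  proof -
    have "remove_point i D ! (j - 1) = D ! (\<sigma> j - 1)" if "j \<in> set r" for j
    proof -
      \<comment> \<open>Entries of \<open>r\<close> stay below \<open>n\<close>, so only the shift
        matters here: from \<open>i\<close> on, the shortened data set holds the entry of
        \<open>D\<close> one position later.\<close>
      have "j \<in> {1..n - 1}" using that \<open>r \<in> seqs (n - 1)\<close> by (auto simp: seqs_def in_lists_conv_set)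
      then show ?thesis
        using i D by (auto simp: remove_point_def \<sigma>_def nth_append min_def)
    qed
    then show ?thesis by (simp add: resample_def)
  qed
  ultimately show thesis by (rule that)
qed

section \<open>The bagged output and its leave-one-out difference\<close>

lemma space_unif01 [simp]: "space unif01 = {0..1}"
  by (simp add: unif01_def space_restrict_space)

lemma prob_space_unif01: "prob_space unif01"
proof
  show "emeasure unif01 (space unif01) = 1"
    unfolding space_unif01 unfolding unif01_def by (subst emeasure_restrict_space) auto
qed

lemma randomized_algorithm_measurable:
  assumes "randomized_algorithm W A"
  shows "A D \<in> borel_measurable unif01" "\<And>t. t \<in> {0..1} \<Longrightarrow> A D t \<in> W"
  using assms by (auto simp: randomized_algorithm_def measurable_restrict_space2_iff Pi_iff)

text \<open>Averaging does not leave a closed ball. With \<open>c = 0\<close> this bounds the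
  expected outputs, with \<open>c\<close> in \<open>W\<close> it places them within the radius seen
  from \<open>c\<close>.\<close>

lemma norm_expectation_minus_le:
  fixes f :: "'a \<Rightarrow> 'h::{banach, second_countable_topology}"
  assumes "prob_space M" "f \<in> borel_measurable M" "\<And>x. x \<in> space M \<Longrightarrow> norm (f x - c) \<le> R"
  shows "norm ((\<integral>x. f x \<partial>M) - c) \<le> R"
proof -
  interpret prob_space M by fact
  have int: "integrable M (\<lambda>x. f x - c)"
    by (rule integrable_const_bound[where B = R]) (use assms in auto)
  then have "integrable M f" using Bochner_Integration.integrable_add[of M _ "\<lambda>_. c"] by fastforce
  then have "(\<integral>x. f x \<partial>M) - c = (\<integral>x. f x - c \<partial>M)" by (simp add: prob_space)
  also have "norm \<dots> \<le> (\<integral>x. norm (f x - c) \<partial>M)" by (rule integral_norm_bound)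
  also have "\<dots> \<le> (\<integral>x. R \<partial>M)" using int assms(3) by (intro integral_mono) auto
  finally show ?thesis by (simp add: prob_space)
qed

text \<open>Fubini. Joint measurability follows from measurability in the seed alone because there
  are only countably many bags.\<close>

lemma derandomized_bagging_eq:
  fixes A :: "'z list \<Rightarrow> real \<Rightarrow> 'h::{banach, second_countable_topology}"
  assumes "bounded W" "randomized_algorithm W A"
  shows "derandomized_bagging A Q D
    = measure_pmf.expectation (Q (length D)) (\<lambda>r. \<integral>\<xi>. A (resample D r) \<xi> \<partial>unif01)"
proof -
  interpret U: prob_space unif01 by (rule prob_space_unif01)
  interpret P: pair_prob_space "measure_pmf (Q (length D))" unif01 ..
  obtain B where B: "\<And>w. w \<in> W \<Longrightarrow> norm w \<le> B"
    using \<open>bounded W\<close> by (auto simp: bounded_iff)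
  let ?P = "measure_pmf (Q (length D)) \<Otimes>\<^sub>M unif01"
  have "(\<lambda>(r, \<xi>). A (resample D r) \<xi>) \<in> borel_measurable (count_space UNIV \<Otimes>\<^sub>M unif01)"
    by (rule measurable_pair_measure_countable1)
       (auto simp: randomized_algorithm_measurable[OF assms(2)])
  then have "(\<lambda>(r, \<xi>). A (resample D r) \<xi>) \<in> borel_measurable ?P"
    by (simp cong: measurable_cong_sets sets_pair_measure_cong)
  then have "integrable ?P (\<lambda>(r, \<xi>). A (resample D r) \<xi>)"
    by (intro P.P.integrable_const_bound[where B = B])
       (auto simp: space_pair_measure intro!: AE_I2 B randomized_algorithm_measurable[OF assms(2)])
  from P.integral_fst'[OF this] show ?thesis
    by (simp add: derandomized_bagging_def)
qed

text \<open>The leave-one-out output is the mean of \<open>f\<close> over bags avoiding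
  \<open>i\<close>, that is, the mean of \<open>(1 - in_bag i r) *\<^sub>R f r\<close> divided by 1
  - p. Subtracting it from the mean of \<open>f\<close> leaves the covariance of
  \<open>in_bag i\<close> with \<open>f\<close>, divided by 1 - p.\<close>

lemma bagging_minus_leave_one_out:
  fixes A :: "'z list \<Rightarrow> real \<Rightarrow> 'h::{banach, second_countable_topology}"
  assumes "bounded W" "randomized_algorithm W A"
    and seqs: "set_pmf (Q n) \<subseteq> seqs n" "set_pmf (Q (n - 1)) \<subseteq> seqs (n - 1)"
    and sym: "symmetric_resampling n (Q n)"
    and "nontrivial_subsampling n (Q n)"
    and loo: "leave_one_out_compatible n (Q n) (Q (n - 1))"
    and D: "length D = n" and i: "i \<in> {1..n}"
  defines "p \<equiv> subsampling_rate n (Q n)"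
    and "f \<equiv> \<lambda>r. \<integral>\<xi>. A (resample D r) \<xi> \<partial>unif01"
  shows "derandomized_bagging A Q D - derandomized_bagging A Q (remove_point i D)
    = (1 / (1 - p)) *\<^sub>R measure_pmf.expectation (Q n) (\<lambda>r. (in_bag i r - p) *\<^sub>R (f r - c))"
proof -
  have p1: "p < 1" using assms(6) by (simp add: nontrivial_subsampling_def p_def)
  obtain B where B: "\<And>w. w \<in> W \<Longrightarrow> norm w \<le> B"
    using \<open>bounded W\<close> by (auto simp: bounded_iff)
  have fb: "norm (f r) \<le> B" for r
    using norm_expectation_minus_le[OF prob_space_unif01, of "A (resample D r)" 0 B]
      randomized_algorithm_measurable[OF assms(2)] B by (auto simp: f_def)
  have intf: "integrable (Q n) f" by (rule integrable_pmf_bounded) (rule fb)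
  have intX: "integrable (Q n) (in_bag i)"
    by (rule integrable_pmf_bounded[where B = 1]) (simp add: in_bag_def)
  have intXf: "integrable (Q n) (\<lambda>r. in_bag i r *\<^sub>R f r)"
    by (rule integrable_pmf_bounded[where B = B])
       (use fb order_trans[OF norm_ge_zero fb] in \<open>auto simp: in_bag_def\<close>)
  obtain \<sigma> where \<sigma>: "\<sigma> permutes {1..n}" "\<sigma> n = i"
    "\<And>r. r \<in> seqs (n - 1) \<Longrightarrow> resample (remove_point i D) r = resample D (map \<sigma> r)"
    using remove_point_permutation[OF i D] by blast
  have "n \<in> {1..n}" using i by auto
  note En = expectation_in_bag[OF sym seqs(1) this]
  have prob: "measure_pmf.prob (Q n) {r. n \<notin> set r} = 1 - p"
    unfolding prob_notin_bag En p_def ..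
  \<comment> \<open>The conditioning event has probability 1 - p > 0, so \<open>cond_pmf\<close> is
    a genuine conditional distribution.\<close>
  then have ne: "set_pmf (Q n) \<inter> {r. n \<notin> set r} \<noteq> {}"
    using p1 measure_Int_set_pmf[of "Q n" "{r. n \<notin> set r}"] by (auto simp: Int_commute)
  have "length (remove_point i D) = n - 1"
    using i D by (auto simp: remove_point_def)
  then have "derandomized_bagging A Q (remove_point i D)
      = measure_pmf.expectation (Q (n - 1)) (\<lambda>r. \<integral>\<xi>. A (resample (remove_point i D) r) \<xi> \<partial>unif01)"
    by (simp add: derandomized_bagging_eq[OF assms(1,2)])
  also have "\<dots> = measure_pmf.expectation (Q (n - 1)) (\<lambda>r. f (map \<sigma> r))"
    using seqs(2) \<sigma>(3) by (intro integral_cong_AE) (auto simp: AE_measure_pmf_iff f_def subset_iff)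
  also have "\<dots> = (1 / (1 - p)) *\<^sub>R
      measure_pmf.expectation (Q n) (\<lambda>r. indicator {r. n \<notin> set r} r *\<^sub>R f (map \<sigma> r))"
    using loo unfolding leave_one_out_compatible_def
    by (simp add: expectation_cond_pmf[OF ne] prob)
  \<comment> \<open>Since \<sigma> maps \<open>n\<close> to \<open>i\<close>, the integrand becomes
    a function of \<open>map \<sigma> r\<close> alone, and symmetry then removes \<sigma>.\<close>
  also have "(\<lambda>r. indicator {r. n \<notin> set r} r *\<^sub>R f (map \<sigma> r))
      = (\<lambda>r. (\<lambda>r. (1 - in_bag i r) *\<^sub>R f r) (map \<sigma> r))"
    using in_bag_map[OF \<sigma>(1), of n] \<sigma>(2) by (auto simp: in_bag_def fun_eq_iff)
  also have "measure_pmf.expectation (Q n) \<dots>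
      = measure_pmf.expectation (Q n) (\<lambda>r. (1 - in_bag i r) *\<^sub>R f r)"
    by (rule symmetric_resampling_expectation[OF sym seqs(1) \<sigma>(1)])
  also have "\<dots> = measure_pmf.expectation (Q n) f - measure_pmf.expectation (Q n) (\<lambda>r. in_bag i r *\<^sub>R f r)"
    using intf intXf by (simp add: scaleR_diff_left)
  finally have wi: "derandomized_bagging A Q (remove_point i D) = (1 / (1 - p)) *\<^sub>R
    (measure_pmf.expectation (Q n) f - measure_pmf.expectation (Q n) (\<lambda>r. in_bag i r *\<^sub>R f r))" .
  have w: "derandomized_bagging A Q D = measure_pmf.expectation (Q n) f"
    by (simp add: derandomized_bagging_eq[OF assms(1,2)] D f_def)
  \<comment> \<open>The shift by \<open>c\<close> is free: \<open>in_bag i\<close> has mean p, so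
    the terms in \<open>c\<close> cancel.\<close>
  have "measure_pmf.expectation (Q n) (\<lambda>r. (in_bag i r - p) *\<^sub>R (f r - c))
      = measure_pmf.expectation (Q n) (\<lambda>r. in_bag i r *\<^sub>R f r - p *\<^sub>R f r - (in_bag i r *\<^sub>R c - p *\<^sub>R c))"
    by (simp add: algebra_simps)
  also have "\<dots> = measure_pmf.expectation (Q n) (\<lambda>r. in_bag i r *\<^sub>R f r)
      - p *\<^sub>R measure_pmf.expectation (Q n) f"
    using intf intX intXf expectation_in_bag[OF sym seqs(1) i] by (simp add: p_def)
  finally have "measure_pmf.expectation (Q n) (\<lambda>r. (in_bag i r - p) *\<^sub>R (f r - c))
     = (1 - p) *\<^sub>R measure_pmf.expectation (Q n) f
       - (measure_pmf.expectation (Q n) f - measure_pmf.expectation (Q n) (\<lambda>r. in_bag i r *\<^sub>R f r))"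
    by (simp add: algebra_simps)
  then show ?thesis
    unfolding w wi using p1 by (simp add: scaleR_diff_right)
qed

section \<open>Passage to the radius, and the stability bound\<close>

lemma bdd_above_norm_diff:
  fixes W :: "'h::real_normed_vector set"
  assumes "bounded W"
  shows "bdd_above ((\<lambda>w. norm (c - w)) ` W)"
proof -
  obtain B where B: "\<And>w. w \<in> W \<Longrightarrow> norm w \<le> B"
    using assms by (auto simp: bounded_iff)
  have "norm (c - w) \<le> norm c + B" if "w \<in> W" for w
    using B[OF that] norm_triangle_ineq4[of c w] by linarith
  then show ?thesis by (rule bdd_aboveI2)
qed

text \<open>The radius is an infimum of distances while the bound holds for their squares, so the
  comparison is made after taking square roots. \<open>max 0 L\<close> keeps the root meaningful
  when \<open>L\<close> is negative; K = 0, where dividing is impossible, is treated apart.\<close>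

lemma le_rad_squared_mult:
  fixes W :: "'h::real_normed_vector set"
  assumes "W \<noteq> {}" "K \<ge> 0"
    and le: "\<And>c. c \<in> W \<Longrightarrow> L \<le> (SUP w\<in>W. norm (c - w))\<^sup>2 * K"
    and "bounded W"
  shows "L \<le> (rad W)\<^sup>2 * K"
proof (cases "K = 0")
  case True
  then show ?thesis using le \<open>W \<noteq> {}\<close> by fastforce
next
  case False
  then have K: "K > 0" using \<open>K \<ge> 0\<close> by simp
  have nonneg: "0 \<le> (SUP w\<in>W. norm (c - w))" if "c \<in> W" for c
    using that \<open>bounded W\<close>
    by (intro cSUP_upper2[of _ _ c] bdd_above_norm_diff) auto
  have "sqrt (max 0 L / K) \<le> rad W"
    unfolding rad_def
  proof (rule cINF_greatest)
    fix c assume c: "c \<in> W"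
    have "max 0 L / K \<le> (SUP w\<in>W. norm (c - w))\<^sup>2"
      using le[OF c] K by (simp add: field_simps)
    then show "sqrt (max 0 L / K) \<le> (SUP w\<in>W. norm (c - w))"
      using nonneg[OF c] by (simp add: real_le_lsqrt)
  qed fact
  then have "max 0 L / K \<le> (rad W)\<^sup>2"
    using K by (simp add: sqrt_le_D)
  then show ?thesis using K by (simp add: field_simps)
qed

theorem theorem6:
  fixes n :: nat
    and W :: "'h::{real_inner, banach, second_countable_topology} set"
    and A :: "'z list \<Rightarrow> real \<Rightarrow> 'h"
    and Q :: "nat \<Rightarrow> nat list pmf"
  assumes "n \<ge> 2"
    and "W \<noteq> {}" and "convex W" and "closed W" and "bounded W"
    and "randomized_algorithm W A"
    and "set_pmf (Q n) \<subseteq> seqs n" and "set_pmf (Q (n - 1)) \<subseteq> seqs (n - 1)"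
    and "symmetric_resampling n (Q n)"
    and "nontrivial_subsampling n (Q n)"
    and "nonpositive_covariance n (Q n)"
    and "leave_one_out_compatible n (Q n) (Q (n - 1))"
  shows "mean_square_stable n
           ((rad W)\<^sup>2 / real (n - 1) * (subsampling_rate n (Q n) / (1 - subsampling_rate n (Q n))))
           (\<lambda>D \<xi>. derandomized_bagging A Q D)"
proof -
  interpret U: prob_space unif01 by (rule prob_space_unif01)
  define p where "p = subsampling_rate n (Q n)"
  define K where "K = p / (1 - p) / real (n - 1)"
  have p1: "p < 1" using assms(10) by (simp add: nontrivial_subsampling_def p_def)
  have p_eq: "measure_pmf.expectation (Q n) (in_bag i) = p" if "i \<in> {1..n}" for i
    unfolding p_def using that by (rule expectation_in_bag[OF assms(9,7)])
  have p0: "p \<ge> 0"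
    using p_eq[of 1] assms(1) Bochner_Integration.integral_nonneg[of "measure_pmf (Q n)" "in_bag 1"] by (simp add: in_bag_def)
  have main: "1 / real n * (\<Sum>i = 1..n. (norm (derandomized_bagging A Q D
      - derandomized_bagging A Q (remove_point i D)))\<^sup>2) \<le> (SUP w\<in>W. norm (c - w))\<^sup>2 * K"
    if D: "length D = n" and c: "c \<in> W" for D c
  proof -
    define R where "R = (SUP w\<in>W. norm (c - w))"
    define f where "f r = (\<integral>\<xi>. A (resample D r) \<xi> \<partial>unif01)" for r
    define v where "v i = measure_pmf.expectation (Q n) (\<lambda>r. (in_bag i r - p) *\<^sub>R (f r - c))" for i
    have upper: "norm (w - c) \<le> R" if "w \<in> W" for w
      unfolding R_def norm_minus_commute[of w c] using that \<open>bounded W\<close>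
      by (intro cSUP_upper bdd_above_norm_diff) auto
    have fb: "norm (f r - c) \<le> R" for r
      unfolding f_def using randomized_algorithm_measurable[OF assms(6)] upper
      by (intro norm_expectation_minus_le[OF prob_space_unif01]) auto
    \<comment> \<open>Bessel for the centered indicators and \<open>f - c\<close>. The reference
      pair is (1, 2), available because \<open>n\<close> is at least 2.\<close>
    have "(\<Sum>i\<in>{1..n}. (norm (v i))\<^sup>2) \<le> R\<^sup>2 * (p * (1 - p) * card {1..n} / (card {1..n} - 1))"
      unfolding v_def
    proof (rule exchangeable_bessel)
      show "\<bar>in_bag i r - p\<bar> \<le> 1" for i r using p0 p1 by (auto simp: in_bag_def)
      show "measure_pmf.expectation (Q n) (\<lambda>r. (in_bag i r - p) * (in_bag j r - p))
        = (if i = j then p * (1 - p) else covariance (measure_pmf (Q n)) (in_bag 1) (in_bag 2))"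
        if "i \<in> {1..n}" "j \<in> {1..n}" for i j
        unfolding p_def using that assms(1) by (intro expectation_centered_in_bag[OF assms(9,7)]) auto
      show "covariance (measure_pmf (Q n)) (in_bag 1) (in_bag 2) \<le> 0"
        using assms(1,11) by (simp add: nonpositive_covariance_def)
    qed (use assms(1) fb in auto)
    then have "(1 / real n * (1 / (1 - p))\<^sup>2) * (\<Sum>i = 1..n. (norm (v i))\<^sup>2)
        \<le> (1 / real n * (1 / (1 - p))\<^sup>2) * (R\<^sup>2 * (p * (1 - p) * real n / (n - 1)))"
      by (intro mult_left_mono) auto
    \<comment> \<open>The factor p (1 - p) from the variance meets (1 - p)^2 from the conditioning,
      leaving p / (1 - p), and the averaging factor 1 / n cancels \<open>n\<close>.\<close>
    also have "\<dots> = R\<^sup>2 * K"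
    proof -
      have "real n > 0" "real (n - 1) > 0" "1 - p > 0" using p1 assms(1) by auto
      then show ?thesis
        unfolding K_def by (simp add: power2_eq_square)
    qed
    also have "1 / real n * (1 / (1 - p))\<^sup>2 * (\<Sum>i = 1..n. (norm (v i))\<^sup>2)
        = 1 / real n * (\<Sum>i = 1..n. (norm (derandomized_bagging A Q D
            - derandomized_bagging A Q (remove_point i D)))\<^sup>2)"
    proof -
      have "(norm (derandomized_bagging A Q D - derandomized_bagging A Q (remove_point i D)))\<^sup>2
          = (1 / (1 - p))\<^sup>2 * (norm (v i))\<^sup>2" if "i \<in> {1..n}" for i
        using bagging_minus_leave_one_out[OF assms(5-10,12) D that, of c]
        by (simp add: v_def f_def p_def power_divide)
      then show ?thesis by (simp only: sum_distrib_left mult.assoc cong: sum.cong)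
    qed
    finally show ?thesis unfolding R_def .
  qed
  have "K \<ge> 0" using p0 p1 by (simp add: K_def)
  then have "1 / real n * (\<Sum>i = 1..n. (norm (derandomized_bagging A Q D
      - derandomized_bagging A Q (remove_point i D)))\<^sup>2) \<le> (rad W)\<^sup>2 * K" if "length D = n" for D
    using main[OF that] assms(2,5) by (intro le_rad_squared_mult) auto
  moreover have "(rad W)\<^sup>2 / real (n - 1) * (p / (1 - p)) = (rad W)\<^sup>2 * K"
    by (simp add: K_def)
  \<comment> \<open>The output ignores the seed, so the integrals over \<open>unif01\<close> are
    integrals of constants and reduce to them by total mass 1.\<close>
  moreover have "U.prob {0..1} = 1"
    using U.prob_space by simp
  ultimately show ?thesis
    unfolding mean_square_stable_def p_def[symmetric] by simp
qed

end
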